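(* Let $q$ be an odd prime power with $q\equiv 1\pmod 3$, let $m=(q-1)/3$, and let $\gamma$ be a generator of the multiplicative group $\mathbf{F}_q^*$. For $k\in\{0,1,\dots,m-1\}$ define $a,b,c\in\mathbf{F}_q^*$ by $$a=\frac{2\gamma^{3k}}{3},\qquad b=\frac{1}{3},\qquad c=\frac{-\gamma^{3k}}{3}.$$ Then the polynomial $$g(x)=ax^{3m-1}+bx^{2m+1}+cx^{2m-1}+bx^{m+1}+cx^{m-1}+bx$$ is a permutation polynomial over $\mathbf{F}_q$, and the permutation of $\mathbf{F}_q$ it induces is an involution with exactly $m+1$ fixed points.
   Context: $\mathbf{F}_q$ denotes the finite field with $q$ elements. A permutation polynomial over $\mathbf{F}_q$ is a polynomial $g\in\mathbf{F}_q[x]$ whose associated map $\mathbf{F}_q\to\mathbf{F}_q$, $x\mapsto g(x)$, is a bijection; it is involutory if $g(g(x))=x$ for all $x\in\mathbf{F}_q$. *)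

theory Defs
  imports "HOL-Library.Cardinality" "HOL-Computational_Algebra.Polynomial"
    "HOL-Number_Theory.Cong" "HOL-Number_Theory.Prime_Powers"
begin

text \<open>The finite field with \<open>q\<close> elements is a type \<open>'a\<close> of class \<open>{field, finite}\<close>
  with \<open>CARD('a) = q\<close>; its multiplicative group is \<open>UNIV - {0}\<close>.\<close>

definition mult_group_generator :: "'a::field \<Rightarrow> bool" where
  "mult_group_generator \<gamma> \<longleftrightarrow> \<gamma> \<noteq> 0 \<and> range (\<lambda>i::int. \<gamma> powi i) = UNIV - {0}"

definition permutation_poly :: "'a::{field,finite} poly \<Rightarrow> bool" where
  "permutation_poly g \<longleftrightarrow> bij (poly g)"

definition involutory_poly :: "'a::{field,finite} poly \<Rightarrow> bool" where
  "involutory_poly g \<longleftrightarrow> (\<forall>x. poly g (poly g x) = x)"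

end

theory Submission
  imports "HOL-Number_Theory.Residues" Defs
begin

text \<open>On the non-zero elements, the average \<open>e = (1 + x ^ m + x ^ (2 * m)) / 3\<close> is the indicator
  function of the \<open>m\<close>-th roots of unity, because \<open>x ^ m\<close> is a cube root of unity. With
  \<open>t = \<gamma> ^ (3 * k)\<close>, the polynomial of the theorem agrees with \<open>e * x + (1 - e) * t / x\<close>, so it fixes
  \<open>0\<close> and the \<open>m\<close>-th roots of unity and sends any other \<open>x\<close> to \<open>t / x\<close>. As \<open>t ^ m = 1\<close>, the map
  \<open>x \<mapsto> t / x\<close> preserves the non-roots; it has no fixed point among them, since \<open>x\<^sup>2 = t\<close> would give
  \<open>(x ^ m)\<^sup>2 = 1 = (x ^ m) ^ 3\<close> and hence \<open>x ^ m = 1\<close>. The same argument works with any odd divisor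
  \<open>n\<close> of \<open>q - 1\<close> in place of \<open>3\<close>.\<close>

lemma of_nat_neq_0_if_dvd_CARD_minus_1:
  assumes "n dvd CARD('a) - 1"
  shows "of_nat n \<noteq> (0 :: 'a :: {field,finite})"
proof
  assume "of_nat n = (0 :: 'a)"
  then have "CHAR('a) dvd CARD('a) - 1"
    using assms by (metis of_nat_eq_0_iff_char_dvd dvd_trans)
  moreover have "CHAR('a) dvd CARD('a)"
    by (rule CHAR_dvd_CARD)
  ultimately have "CHAR('a) dvd 1"
    by (rule dvd_diffD1) simp
  then show False
    by simp
qed

text \<open>The class \<open>finite_field\<close> of the library's \<open>finite_field_power_card_eq_same\<close> does not follow
  from \<open>{field,finite}\<close>.\<close>

lemma power_CARD_minus_1_eq_1:
  fixes x :: "'a :: {field,finite}"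
  assumes "x \<noteq> 0"
  shows "x ^ (CARD('a) - 1) = 1"
proof -
  have "(\<Prod>y\<in>UNIV - {0}. x * y) = (\<Prod>y\<in>UNIV - {0}. y)"
    using assms
    by (intro prod.reindex_bij_witness[of _ "\<lambda>y. y / x" "\<lambda>y. x * y"]) auto
  moreover have "(\<Prod>y\<in>UNIV - {0}. y) \<noteq> (0 :: 'a)"
    by simp
  ultimately show ?thesis
    by (simp add: prod.distrib card_Diff_singleton)
qed

lemma power_cofactor_root_of_unity:
  fixes x :: "'a :: {field,finite}"
  assumes "CARD('a) - 1 = n * m" "x \<noteq> 0"
  shows "(x ^ m) ^ n = 1"
  using power_CARD_minus_1_eq_1[OF assms(2)] assms(1)
  by (simp add: mult.commute flip: power_mult)

lemma card_power_eq_le: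
  fixes c :: "'a :: idom"
  assumes "0 < n"
  shows "card {x. x ^ n = c} \<le> n"
proof -
  let ?p = "monom 1 n - [:c:]"
  have degree: "degree ?p = n"
    using assms by (simp add: degree_monom_eq degree_add_eq_left flip: add_uminus_conv_diff)
  then have "?p \<noteq> 0"
    using assms by auto
  from card_poly_roots_bound[OF this] show ?thesis
    by (simp add: degree poly_monom)
qed

lemma card_roots_of_unity_finite_field:
  assumes "CARD('a) - 1 = n * m" "0 < n" "0 < m"
  shows "card {x :: 'a :: {field,finite}. x ^ m = 1} = m" (is "card ?R = m")
proof (rule antisym)
  show "card ?R \<le> m"
    using assms(3) by (rule card_power_eq_le)
  have "(x ^ n) ^ m = 1" if "x \<noteq> 0" for x :: 'a
    using assms(1) that by (intro power_cofactor_root_of_unity) (simp_all add: mult.commute)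
  then have "UNIV - {0 :: 'a} \<subseteq> (\<Union>y\<in>?R. {x. x ^ n = y})"
    by auto
  then have "card (UNIV - {0 :: 'a}) \<le> card (\<Union>y\<in>?R. {x. x ^ n = y})"
    by (intro card_mono) auto
  also have "\<dots> \<le> (\<Sum>y\<in>?R. card {x. x ^ n = y})"
    by (intro card_UN_le) auto
  also have "\<dots> \<le> card ?R * n"
    using assms(2) by (intro sum_bounded_above[THEN order_trans]) (auto intro: card_power_eq_le)
  finally show "m \<le> card ?R"
    using assms(1,2) by (simp add: card_Diff_singleton mult.commute)
qed

lemma sum_powers_root_of_unity:
  fixes w :: "'a :: field"
  assumes "w ^ n = 1"
  shows "(\<Sum>i<n. w ^ i) = (if w = 1 then of_nat n else 0)"
  using assms by (simp add: sum_gp_strict)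

lemma eq_1_if_odd_power_eq_1:
  fixes w :: "'a :: monoid_mult"
  assumes "w\<^sup>2 = 1" "w ^ n = 1" "odd n"
  shows "w = 1"
proof -
  obtain j where "n = 2 * j + 1"
    using assms(3) by (rule oddE)
  then show ?thesis
    using assms(1,2) by (simp add: power_mult)
qed

text \<open>For \<open>0 < m\<close> this fixes \<open>0\<close>, because \<open>t / 0 = 0\<close>.\<close>

definition invert_nonroots :: "nat \<Rightarrow> 'a \<Rightarrow> 'a \<Rightarrow> 'a :: field" where
  "invert_nonroots m t x = (if x ^ m = 1 then x else t / x)"

lemma invert_nonroots_involution:
  assumes "t ^ m = 1"
  shows "invert_nonroots m t (invert_nonroots m t x) = x"
proof (cases "x ^ m = 1")
  case True
  then show ?thesis
    by (simp add: invert_nonroots_def)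
next
  case False
  then have "t \<noteq> 0" "(t / x) ^ m \<noteq> 1"
    using assms by (auto simp: power_divide power_0_left split: if_splits)
  with False show ?thesis
    by (simp add: invert_nonroots_def)
qed

lemma fixed_points_invert_nonroots:
  fixes t :: "'a :: {field,finite}"
  assumes "CARD('a) - 1 = n * m" "odd n" "t ^ m = 1"
  shows "{x. invert_nonroots m t x = x} = insert 0 {x. x ^ m = 1}"
proof -
  have "x ^ m = 1" if "invert_nonroots m t x = x" "x \<noteq> 0" for x
  proof (rule ccontr)
    assume "x ^ m \<noteq> 1"
    with that have "x\<^sup>2 = t"
      by (simp add: invert_nonroots_def field_simps power2_eq_square)
    then have "(x ^ m)\<^sup>2 = 1"
      using assms(3) by (metis power_mult mult.commute)
    moreover have "(x ^ m) ^ n = 1"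
      using assms(1) that(2) by (rule power_cofactor_root_of_unity)
    ultimately show False
      using \<open>x ^ m \<noteq> 1\<close> assms(2) eq_1_if_odd_power_eq_1 by blast
  qed
  moreover have "invert_nonroots m t x = x" if "x = 0 \<or> x ^ m = 1" for x
    using that by (auto simp: invert_nonroots_def)
  ultimately show ?thesis
    by blast
qed

lemma card_fixed_points_invert_nonroots:
  fixes t :: "'a :: {field,finite}"
  assumes "CARD('a) - 1 = n * m" "odd n" "0 < m" "t ^ m = 1"
  shows "card {x. invert_nonroots m t x = x} = m + 1"
proof -
  have "0 < n"
    using assms(2) by (rule odd_pos)
  then have "card {x :: 'a. x ^ m = 1} = m"
    using assms(1,3) by (intro card_roots_of_unity_finite_field)
  moreover have "(0 :: 'a) \<notin> {x. x ^ m = 1}"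
    using assms(3) by (simp add: power_0_left)
  ultimately show ?thesis
    by (simp add: fixed_points_invert_nonroots[OF assms(1,2,4)])
qed

definition invert_nonroots_poly :: "nat \<Rightarrow> nat \<Rightarrow> 'a \<Rightarrow> 'a :: field poly" where
  "invert_nonroots_poly n m t =
     (\<Sum>i<n. monom (1 / of_nat n) (i * m + 1)) + monom t (n * m - 1)
     - (\<Sum>i<n. monom (t / of_nat n) (Suc i * m - 1))"

lemma poly_invert_nonroots_poly:
  fixes t x :: "'a :: field"
  assumes "of_nat n \<noteq> (0 :: 'a)" "1 < m" "x \<noteq> 0 \<Longrightarrow> (x ^ m) ^ n = 1"
  shows "poly (invert_nonroots_poly n m t) x = invert_nonroots m t x"
proof (cases "x = 0")
  case True
  have "1 < n * m"
    using assms(1,2) by (cases n) auto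
  with True show ?thesis
    using assms(2)
    by (simp add: invert_nonroots_poly_def invert_nonroots_def poly_sum poly_monom power_0_left)
next
  case False
  then have root: "(x ^ m) ^ n = 1"
    by (rule assms(3))
  have power_minus_1: "x ^ (j - 1) = x ^ j / x" if "0 < j" for j
    using False that by (simp add: power_diff)
  define e where "e = (\<Sum>i<n. (x ^ m) ^ i) / of_nat n"
  have indicator: "e = (if x ^ m = 1 then 1 else 0)"
    using assms(1) by (simp add: e_def sum_powers_root_of_unity[OF root])
  have "(\<Sum>i<n. 1 / of_nat n * x ^ (i * m + 1)) = (\<Sum>i<n. (x ^ m) ^ i * (x / of_nat n))"
    by (simp add: mult.commute flip: power_mult)
  then have "(\<Sum>i<n. 1 / of_nat n * x ^ (i * m + 1)) = e * x"
    by (simp add: e_def sum_distrib_left sum_distrib_right sum_divide_distrib mult_ac)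
  moreover have "t / of_nat n * x ^ (Suc i * m - 1) = (x ^ m) ^ i * (x ^ m * (t / x) / of_nat n)"
    for i
    using assms(2) by (subst power_minus_1) (simp_all add: power_add mult.commute flip: power_mult)
  then have "(\<Sum>i<n. t / of_nat n * x ^ (Suc i * m - 1)) = e * x ^ m * (t / x)"
    by (simp add: e_def sum_distrib_left sum_distrib_right sum_divide_distrib mult_ac)
  moreover have "t * x ^ (n * m - 1) = t / x"
    using root assms(1,2)
    by (subst power_minus_1) (auto simp: mult.commute simp flip: power_mult intro: gr0I)
  ultimately have "poly (invert_nonroots_poly n m t) x = e * x + t / x - e * x ^ m * (t / x)"
    by (simp only: invert_nonroots_poly_def poly_add poly_diff poly_sum poly_monom)
  also have "\<dots> = invert_nonroots m t x"
    by (simp add: indicator invert_nonroots_def)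
  finally show ?thesis .
qed

lemma permutation_poly_if_involutory_poly:
  "involutory_poly g \<Longrightarrow> permutation_poly g"
  unfolding involutory_poly_def permutation_poly_def by (intro involuntory_imp_bij) blast

lemma poly_invert_nonroots_poly_finite_field:
  fixes t :: "'a :: {field,finite}"
  assumes "CARD('a) - 1 = n * m" "1 < m"
  shows "poly (invert_nonroots_poly n m t) = invert_nonroots m t"
proof
  fix x :: 'a
  have "of_nat n \<noteq> (0 :: 'a)"
    using assms(1) by (intro of_nat_neq_0_if_dvd_CARD_minus_1) simp
  then show "poly (invert_nonroots_poly n m t) x = invert_nonroots m t x"
    using assms by (intro poly_invert_nonroots_poly power_cofactor_root_of_unity)
qed

lemma involutory_poly_invert_nonroots_poly:
  fixes t :: "'a :: {field,finite}"
  assumes "CARD('a) - 1 = n * m" "1 < m" "t ^ m = 1"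
  shows "involutory_poly (invert_nonroots_poly n m t)"
  using assms
  by (simp add: involutory_poly_def poly_invert_nonroots_poly_finite_field
      invert_nonroots_involution)

lemma card_fixed_points_invert_nonroots_poly:
  fixes t :: "'a :: {field,finite}"
  assumes "CARD('a) - 1 = n * m" "odd n" "1 < m" "t ^ m = 1"
  shows "card {x. poly (invert_nonroots_poly n m t) x = x} = m + 1"
  using assms
  by (simp add: poly_invert_nonroots_poly_finite_field card_fixed_points_invert_nonroots)

lemma invert_nonroots_poly_3:
  fixes t :: "'a :: field"
  assumes "(3 :: 'a) \<noteq> 0"
  shows "invert_nonroots_poly 3 m t =
     monom (2 * t / 3) (3 * m - 1) + monom (1 / 3) (2 * m + 1) + monom (- t / 3) (2 * m - 1)
     + monom (1 / 3) (m + 1) + monom (- t / 3) (m - 1) + monom (1 / 3) 1"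
proof -
  have "2 * t / 3 = t - t / 3"
    using assms by (simp add: field_simps)
  then have "monom (2 * t / 3) (3 * m - 1) = monom t (3 * m - 1) - monom (t / 3) (3 * m - 1)"
    by (simp add: diff_monom)
  then show ?thesis
    by (simp add: invert_nonroots_poly_def lessThan_nat_numeral add.commute flip: minus_monom mult_2)
qed

theorem theorem2p4:
  fixes \<gamma> a b c :: "'a::{field,finite}"
    and q m k :: nat
    and g :: "'a poly"
  assumes "q = CARD('a)"
    and "primepow q"
    and "odd q"
    and "[q = 1] (mod 3)"
    and "m = (q - 1) div 3"
    and "mult_group_generator \<gamma>"
    and "k \<in> {0..<m}"
    and "a = 2 * \<gamma> ^ (3 * k) / 3"
    and "b = 1 / 3"
    and "c = - (\<gamma> ^ (3 * k)) / 3"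
    and "g = monom a (3 * m - 1) + monom b (2 * m + 1) + monom c (2 * m - 1)
             + monom b (m + 1) + monom c (m - 1) + monom b 1"
  shows "a \<noteq> 0 \<and> b \<noteq> 0 \<and> c \<noteq> 0 \<and>
         permutation_poly g \<and> involutory_poly g \<and>
         card {x. poly g x = x} = m + 1"
proof -
  define t where "t = \<gamma> ^ (3 * k)"
  have card: "CARD('a) - 1 = 3 * m"
    using assms(1,3-5) unfolding cong_def by presburger
  moreover have "0 < m"
    using assms(7) by simp
  ultimately have m: "1 < m"
    using assms(1,3) by presburger
  have three: "(3 :: 'a) \<noteq> 0" and two: "(2 :: 'a) \<noteq> 0"
    using of_nat_neq_0_if_dvd_CARD_minus_1[where 'a = 'a, of 3]
      of_nat_neq_0_if_dvd_CARD_minus_1[where 'a = 'a, of 2] card assms(1,3) by auto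
  have \<gamma>: "\<gamma> \<noteq> 0"
    using assms(6) by (simp add: mult_group_generator_def)
  then have t: "t ^ m = 1"
    using power_cofactor_root_of_unity[OF card, of "\<gamma> ^ k"]
    by (simp add: t_def mult_ac flip: power_mult)
  have g: "g = invert_nonroots_poly 3 m t"
    by (simp only: assms(8-11) invert_nonroots_poly_3[OF three] t_def)
  then have "involutory_poly g"
    using involutory_poly_invert_nonroots_poly[OF card m t] by simp
  moreover have "card {x. poly g x = x} = m + 1"
    using card_fixed_points_invert_nonroots_poly[OF card _ m t] g by simp
  ultimately show ?thesis
    using two three \<gamma> by (simp add: assms(8-10) permutation_poly_if_involutory_poly)
qed

end
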